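(* Let $p$ be a prime with $p\equiv 11\pmod{12}$, and let $G$ be the Eberhard graph with parameter $p$. Then $\overline{G}$ has a model of $K_{\chi(\overline{G})}$ in which every branch set has at most two vertices.
   Context: For a prime $p\equiv 11\pmod{12}$, let $S=\{(x,x^2),(x,-x^2): x\in\mathbb{F}_p\setminus\{0\}\}\subseteq\mathbb{F}_p\times\mathbb{F}_p$. The Eberhard graph with parameter $p$ is the Cayley graph with vertex set $\mathbb{F}_p\times\mathbb{F}_p$ in which $u$ and $v$ are adjacent iff $u-v\in S$. $\overline{G}$ denotes the complement. A model of $K_t$ in a graph is a collection of $t$ pairwise disjoint vertex sets (branch sets), each inducing a connected subgraph, with an edge between every two of them. *)

theory Defs
  imports "HOL-Number_Theory.Residues" "Graph_Theory.Graph_Theory"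
begin

text \<open>
  Simple graphs are represented, as in \<open>Graph_Theory\<close>, by loop-free symmetric sets of
  arcs (locale \<open>pair_graph\<close>).
\<close>

definition complement_graph :: "'a pair_pre_digraph \<Rightarrow> 'a pair_pre_digraph" where
  "complement_graph G =
    \<lparr> pverts = pverts G,
      parcs = {(u, v). u \<in> pverts G \<and> v \<in> pverts G \<and> u \<noteq> v \<and> (u, v) \<notin> parcs G} \<rparr>"

definition proper_colouring :: "'a pair_pre_digraph \<Rightarrow> nat \<Rightarrow> ('a \<Rightarrow> nat) \<Rightarrow> bool" where
  "proper_colouring G k c \<longleftrightarrow>
    (\<forall>v \<in> pverts G. c v < k) \<and> (\<forall>(u, v) \<in> parcs G. c u \<noteq> c v)"

definition chromatic_number :: "'a pair_pre_digraph \<Rightarrow> nat" where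
  "chromatic_number G = (LEAST k. \<exists>c. proper_colouring G k c)"

text \<open>
  The predicate \<open>connected\<close> of \<open>Graph_Theory\<close> is false for the graph without vertices, so
  branch sets are nonempty.
\<close>

definition complete_model :: "'a pair_pre_digraph \<Rightarrow> nat \<Rightarrow> 'a set set \<Rightarrow> bool" where
  "complete_model G t \<B> \<longleftrightarrow>
    finite \<B> \<and> card \<B> = t \<and>
    (\<forall>B \<in> \<B>. B \<subseteq> pverts G \<and> connected (with_proj G \<restriction> B)) \<and>
    (\<forall>B \<in> \<B>. \<forall>C \<in> \<B>. B \<noteq> C \<longrightarrow>
      B \<inter> C = {} \<and> (\<exists>u \<in> B. \<exists>v \<in> C. (u, v) \<in> parcs G))"

definition eberhard_set :: "nat \<Rightarrow> (int \<times> int) set" where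
  "eberhard_set p = (let F = residue_ring (int p) in
    {(x, x [^]\<^bsub>F\<^esub> (2::nat)) | x. x \<in> carrier F - {\<zero>\<^bsub>F\<^esub>}} \<union>
    {(x, \<ominus>\<^bsub>F\<^esub> (x [^]\<^bsub>F\<^esub> (2::nat))) | x. x \<in> carrier F - {\<zero>\<^bsub>F\<^esub>}})"

definition eberhard_graph :: "nat \<Rightarrow> (int \<times> int) pair_pre_digraph" where
  "eberhard_graph p = (let F = residue_ring (int p); V = carrier F \<times> carrier F in
    \<lparr> pverts = V,
      parcs = {(u, v). u \<in> V \<and> v \<in> V \<and>
        (fst u \<ominus>\<^bsub>F\<^esub> fst v, snd u \<ominus>\<^bsub>F\<^esub> snd v) \<in> eberhard_set p} \<rparr>)"

lemma pair_graph_complement_graph: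
  assumes "pair_graph G"
  shows "pair_graph (complement_graph G)"
proof -
  interpret pair_graph G by fact
  have "finite (parcs (complement_graph G))"
    by (rule finite_subset[of _ "pverts G \<times> pverts G"])
      (auto simp: complement_graph_def pair_finite_verts)
  moreover have "symmetric (with_proj (complement_graph G))"
    using pair_sym_arcs
    by (auto simp: symmetric_def complement_graph_def sym_def)
  ultimately show ?thesis
    by unfold_locales (auto simp: complement_graph_def pair_finite_verts)
qed

lemma pair_graph_eberhard_graph:
  assumes "1 < p"
  shows "pair_graph (eberhard_graph p)"
proof -
  define F where "F = residue_ring (int p)"
  interpret residues "int p" F
    using assms by unfold_locales (simp_all add: F_def)
  interpret cring F by (rule cring)
  have S: "eberhard_set p =
      {(x, x [^]\<^bsub>F\<^esub> (2::nat)) | x. x \<in> carrier F - {\<zero>\<^bsub>F\<^esub>}} \<union>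
      {(x, \<ominus>\<^bsub>F\<^esub> (x [^]\<^bsub>F\<^esub> (2::nat))) | x. x \<in> carrier F - {\<zero>\<^bsub>F\<^esub>}}"
    by (simp add: eberhard_set_def F_def Let_def)
  have V: "pverts (eberhard_graph p) = carrier F \<times> carrier F"
    by (simp add: eberhard_graph_def F_def Let_def)
  have A: "parcs (eberhard_graph p) =
      {(u, v). u \<in> carrier F \<times> carrier F \<and> v \<in> carrier F \<times> carrier F \<and>
        (fst u \<ominus>\<^bsub>F\<^esub> fst v, snd u \<ominus>\<^bsub>F\<^esub> snd v) \<in> eberhard_set p}"
    by (simp add: eberhard_graph_def F_def Let_def)
  have fin: "finite (carrier F)"
    by (simp add: F_def residue_ring_def)
  have sq: "(\<ominus>\<^bsub>F\<^esub> x) [^]\<^bsub>F\<^esub> (2::nat) = x [^]\<^bsub>F\<^esub> (2::nat)" if "x \<in> carrier F" for x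
    using that by (simp add: numeral_2_eq_2 l_minus r_minus)
  have neg: "(\<ominus>\<^bsub>F\<^esub> x, \<ominus>\<^bsub>F\<^esub> y) \<in> eberhard_set p"
    if "(x, y) \<in> eberhard_set p" for x y
  proof -
    have x: "x \<in> carrier F" "x \<noteq> \<zero>\<^bsub>F\<^esub>"
      and y: "y = x [^]\<^bsub>F\<^esub> (2::nat) \<or> y = \<ominus>\<^bsub>F\<^esub> (x [^]\<^bsub>F\<^esub> (2::nat))"
      using that by (auto simp: S)
    have "\<ominus>\<^bsub>F\<^esub> x \<noteq> \<zero>\<^bsub>F\<^esub>"
      using x by (metis minus_minus minus_zero)
    then show ?thesis
      using x y sq[OF x(1)] by (auto simp: S)
  qed
  have diff: "b \<ominus>\<^bsub>F\<^esub> a = \<ominus>\<^bsub>F\<^esub> (a \<ominus>\<^bsub>F\<^esub> b)"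
    if "a \<in> carrier F" "b \<in> carrier F" for a b
    using that by (simp add: minus_eq minus_add a_comm)
  have "symmetric (with_proj (eberhard_graph p))"
    unfolding symmetric_def
  proof (rule symI)
    fix u v
    assume "(u, v) \<in> arcs_ends (with_proj (eberhard_graph p))"
    then have uv: "u \<in> carrier F \<times> carrier F" "v \<in> carrier F \<times> carrier F"
      and d: "(fst u \<ominus>\<^bsub>F\<^esub> fst v, snd u \<ominus>\<^bsub>F\<^esub> snd v) \<in> eberhard_set p"
      by (auto simp: A)
    have "fst v \<ominus>\<^bsub>F\<^esub> fst u = \<ominus>\<^bsub>F\<^esub> (fst u \<ominus>\<^bsub>F\<^esub> fst v)"
      "snd v \<ominus>\<^bsub>F\<^esub> snd u = \<ominus>\<^bsub>F\<^esub> (snd u \<ominus>\<^bsub>F\<^esub> snd v)"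
      using uv by (auto intro!: diff)
    then show "(v, u) \<in> arcs_ends (with_proj (eberhard_graph p))"
      using uv neg[OF d] by (simp add: A)
  qed
  moreover have "finite (parcs (eberhard_graph p))"
    by (rule finite_subset[of _ "(carrier F \<times> carrier F) \<times> (carrier F \<times> carrier F)"])
      (auto simp: A fin)
  moreover have "fst e \<noteq> snd e" if "e \<in> parcs (eberhard_graph p)" for e
    using that by (auto simp: A S minus_eq r_neg)
  ultimately show ?thesis
    by unfold_locales (auto simp: V A fin)
qed

end

theory Submission
  imports Defs
begin

text \<open>
  The step \<open>(1, 1)\<close>, replaced by \<open>(1, -1)\<close> whenever the first coordinate wraps around, traces out a
  Hamiltonian path of \<open>G\<close>, and grouping its consecutive vertices in twos colours the complement with
  \<open>(p\<^sup>2 + 1) / 2\<close> colours. An involution of the vertices has at least that many orbits because \<open>p\<^sup>2\<close>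
  is odd, so it suffices to find one that moves no vertex to a neighbour and has no two orbits
  completely joined in \<open>G\<close>.

  A common neighbour \<open>(a, b)\<close> of two vertices \<open>(x, y)\<close>, \<open>(x, z)\<close> of one column satisfies
  \<open>{y - b, z - b} = {(x - a)\<^sup>2, -(x - a)\<^sup>2}\<close>, so \<open>y + z = 2b\<close>. Hence, if each column \<open>x\<close> is reflected
  in a centre \<open>c x\<close>, then \<open>c x\<close> is the second coordinate of every common neighbour of a pair in
  column \<open>x\<close>, and no such pair is completely joined to a pair with distinct second coordinates.
  Let \<open>c\<close> be 1 at 0, and 0 at odd \<open>x\<close> and 2 at even \<open>x\<close> with \<open>0 < x < p\<close>. The centre \<open>(0, 1)\<close> is
  fixed; its level 1 is the centre of no other column. For \<open>x\<close> odd, \<open>(x, 0)\<close> is exchanged with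
  \<open>(x + 1, 2)\<close>. Two orbits of centres are not completely joined, because the squares of \<open>d\<close> and
  \<open>d \<plusminus> 1\<close> would then have incompatible residues.
\<close>

section \<open>Colourings and models in complements\<close>

lemma chromatic_number_le:
  assumes "proper_colouring G k c"
  shows "chromatic_number G \<le> k"
  unfolding chromatic_number_def using assms by (intro Least_le) blast

lemma chromatic_number_complement_le_spanning_walk:
  assumes "pair_graph G"
    and spanning: "pverts G \<subseteq> w ` {..<n}"
    and step: "\<And>i. Suc i < n \<Longrightarrow> (w i, w (Suc i)) \<in> parcs G"
  shows "chromatic_number (complement_graph G) \<le> (n + 1) div 2"
proof -
  interpret pair_graph G by fact
  define pos where "pos = inv_into {..<n} w"
  have pos: "pos v < n" "w (pos v) = v" if "v \<in> pverts G" for v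
    using that spanning inv_into_into[of v w "{..<n}"] f_inv_into_f[of v w "{..<n}"]
    by (auto simp: pos_def)
  have adjacent: "(u, v) \<in> parcs G"
    if "u \<in> pverts G" "v \<in> pverts G" "u \<noteq> v" "pos u div 2 = pos v div 2" for u v
  proof -
    have "pos u \<noteq> pos v" using pos(2) that(1-3) by metis
    with that(4) consider "pos v = Suc (pos u)" | "pos u = Suc (pos v)" by linarith
    then show ?thesis
      using step pos that(1,2) arcs_symmetric by cases metis+
  qed
  have "pos v div 2 < (n + 1) div 2" if "v \<in> pverts G" for v
    using pos(1)[OF that] by linarith
  with adjacent have "proper_colouring (complement_graph G) ((n + 1) div 2) (\<lambda>v. pos v div 2)"
    by (auto simp: proper_colouring_def complement_graph_def)
  then show ?thesis by (rule chromatic_number_le)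
qed

lemma connected_induce_pair:
  assumes "u \<noteq> v \<Longrightarrow> (u, v) \<in> parcs G"
  shows "connected (with_proj G \<restriction> {u, v})"
proof -
  let ?K = "with_proj (mk_symmetric (with_proj G \<restriction> {u, v}))"
  have "u \<rightarrow>\<^sup>*\<^bsub>?K\<^esub> u" "v \<rightarrow>\<^sup>*\<^bsub>?K\<^esub> v"
    by (simp_all add: reachable_def)
  moreover have "u \<rightarrow>\<^sup>*\<^bsub>?K\<^esub> v" "v \<rightarrow>\<^sup>*\<^bsub>?K\<^esub> u" if "u \<noteq> v"
    using assms[OF that]
    by (auto simp: reachable_def mk_symmetric_def
        intro!: rtrancl_on_into_rtrancl_on[OF rtrancl_on_refl])
  ultimately show ?thesis
    unfolding connected_def strongly_connected_def by auto
qed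

lemma complete_model_subset:
  assumes "complete_model G t \<B>" "s \<le> t"
  obtains \<C> where "\<C> \<subseteq> \<B>" "complete_model G s \<C>"
proof -
  obtain \<C> where "\<C> \<subseteq> \<B>" "finite \<C>" "card \<C> = s"
    using assms obtain_subset_with_card_n unfolding complete_model_def by metis
  with assms(1) have "complete_model G s \<C>"
    unfolding complete_model_def by (meson subsetD)
  with \<open>\<C> \<subseteq> \<B>\<close> that show ?thesis by blast
qed

lemma complete_model_complement_involution:
  assumes "finite (pverts G)"
    and closed: "\<And>v. v \<in> pverts G \<Longrightarrow> f v \<in> pverts G"
    and involution: "\<And>v. v \<in> pverts G \<Longrightarrow> f (f v) = v"
    and not_adjacent: "\<And>v. v \<in> pverts G \<Longrightarrow> (v, f v) \<notin> parcs G"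
    and not_joined: "\<And>v w. \<lbrakk>v \<in> pverts G; w \<in> pverts G\<rbrakk> \<Longrightarrow> \<not> {v, f v} \<times> {w, f w} \<subseteq> parcs G"
  defines "\<B> \<equiv> (\<lambda>v. {v, f v}) ` pverts G"
  shows "complete_model (complement_graph G) (card \<B>) \<B>"
  unfolding complete_model_def
proof (intro conjI ballI impI)
  show "finite \<B>" using assms(1) by (simp add: \<B>_def)
next
  fix B assume "B \<in> \<B>"
  then obtain v where v: "v \<in> pverts G" "B = {v, f v}" by (auto simp: \<B>_def)
  with closed show "B \<subseteq> pverts (complement_graph G)" by (simp add: complement_graph_def)
  show "connected (with_proj (complement_graph G) \<restriction> B)"
    unfolding v(2) using v(1) closed not_adjacent
    by (intro connected_induce_pair) (simp add: complement_graph_def)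
next
  fix B C assume "B \<in> \<B>" "C \<in> \<B>" "B \<noteq> C"
  then obtain v w where v: "v \<in> pverts G" "B = {v, f v}" and w: "w \<in> pverts G" "C = {w, f w}"
    by (auto simp: \<B>_def)
  have "B = {a, f a}" if "a \<in> B" for a
    using that v involution by auto
  moreover have "C = {a, f a}" if "a \<in> C" for a
    using that w involution by auto
  ultimately show disjoint: "B \<inter> C = {}"
    using \<open>B \<noteq> C\<close> by (metis disjoint_iff)
  obtain a b where "a \<in> B" "b \<in> C" "(a, b) \<notin> parcs G"
    using not_joined[OF v(1) w(1)] unfolding v(2) w(2) by blast
  moreover from this have "a \<in> pverts G" "b \<in> pverts G" "a \<noteq> b"
    using v w closed disjoint by auto
  ultimately show "\<exists>u\<in>B. \<exists>v\<in>C. (u, v) \<in> parcs (complement_graph G)"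
    by (auto simp: complement_graph_def)
qed simp

lemma card_le_double_card_pairs:
  assumes "finite A"
  shows "card A \<le> 2 * card ((\<lambda>x. {x, f x}) ` A)"
proof -
  let ?P = "(\<lambda>x. {x, f x}) ` A"
  have "card A \<le> card (\<Union>?P)"
    using assms by (intro card_mono) auto
  also have "\<dots> \<le> (\<Sum>B \<in> ?P. card B)"
    by (rule card_Union_le_sum_card)
  also have "\<dots> \<le> (\<Sum>B \<in> ?P. 2)"
    by (intro sum_mono) (auto simp: card_insert_if)
  finally show ?thesis by simp
qed

section \<open>Congruences between squares\<close>

lemma cong_imp_eq_int:
  fixes a b q :: int
  assumes "[a = b] (mod q)" "a \<in> {0..<q}" "b \<in> {0..<q}"
  shows "a = b"
  using assms by (auto intro: cong_less_imp_eq_int)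

lemma cong_double_cancel:
  fixes a b q :: int
  assumes "[2 * a = 2 * b] (mod q)" "odd q"
  shows "[a = b] (mod q)"
  using assms cong_mult_lcancel[of 2 q a b] by simp

lemma cong_consecutive_squares:
  fixes m x e f :: int
  assumes "[x\<^sup>2 = e] (mod m)" "[(x + 1)\<^sup>2 = f] (mod m)"
  shows "[4 * e = (f - e - 1)\<^sup>2] (mod m)"
proof -
  have "[4 * e = 4 * x\<^sup>2] (mod m)"
    using assms(1) by (simp add: cong_sym cong_scalar_left)
  also have "4 * x\<^sup>2 = ((x + 1)\<^sup>2 - x\<^sup>2 - 1)\<^sup>2"
    by (simp add: power2_eq_square algebra_simps)
  also have "[\<dots> = (f - e - 1)\<^sup>2] (mod m)"
    using assms by (rule cong_pow[OF cong_diff[OF cong_diff cong_refl], rotated])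
  finally show ?thesis .
qed

lemma not_consecutive_squares_pm_one:
  fixes m x :: int
  assumes "5 < m"
    and "[x\<^sup>2 = 1] (mod m) \<or> [x\<^sup>2 = -1] (mod m)"
    and "[(x + 1)\<^sup>2 = 1] (mod m) \<or> [(x + 1)\<^sup>2 = -1] (mod m)"
  shows False
proof -
  obtain e f where "e \<in> {1, -1}" "f \<in> {1, -1}" "[4 * e = (f - e - 1)\<^sup>2] (mod m)"
    using assms(2,3) cong_consecutive_squares by blast
  then have "m dvd 3 \<or> m dvd 5" by (auto simp: cong_iff_dvd_diff)
  with assms(1) show False by (auto dest: zdvd_imp_le)
qed

lemma not_zero_square_between_squares_pm_two:
  fixes m d :: int
  assumes "odd m" "5 < m" "[d\<^sup>2 = 0] (mod m)"
    and "[(d - 1)\<^sup>2 = 2] (mod m) \<or> [(d - 1)\<^sup>2 = -2] (mod m)"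
    and "[(d + 1)\<^sup>2 = 2] (mod m) \<or> [(d + 1)\<^sup>2 = -2] (mod m)"
  shows False
proof -
  obtain e f where signs: "e \<in> {1, -1}" "f \<in> {1, -1}"
    and "[(d - 1)\<^sup>2 = 2 * e] (mod m)" "[(d + 1)\<^sup>2 = 2 * f] (mod m)"
    using assms(4,5) by force
  then have "[(d - 1)\<^sup>2 + (d + 1)\<^sup>2 = 2 * (e + f)] (mod m)"
    using cong_add by (fastforce simp: distrib_left)
  moreover have "(d - 1)\<^sup>2 + (d + 1)\<^sup>2 = 2 * (d\<^sup>2 + 1)"
    by (simp add: power2_eq_square algebra_simps)
  ultimately have "[d\<^sup>2 + 1 = e + f] (mod m)"
    using assms(1) by (simp add: cong_double_cancel)
  moreover have "[d\<^sup>2 + 1 = 0 + 1] (mod m)"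
    using assms(3) by (rule cong_add[OF _ cong_refl])
  ultimately have "[1 = e + f] (mod m)"
    by (simp add: cong_def)
  with signs have "m dvd 1 \<or> m dvd 3" by (auto simp: cong_iff_dvd_diff)
  with assms(2) show False by (auto dest: zdvd_imp_le)
qed

section \<open>Eberhard graphs of odd order\<close>

locale odd_eberhard =
  fixes p :: nat
  assumes odd_p: "odd p" and p_gt_1: "1 < p"
begin

abbreviation q :: int where "q \<equiv> int p"

abbreviation V :: "(int \<times> int) set" where "V \<equiv> pverts (eberhard_graph p)"

abbreviation E :: "((int \<times> int) \<times> (int \<times> int)) set" where "E \<equiv> parcs (eberhard_graph p)"

sublocale pair_graph "eberhard_graph p"
  using p_gt_1 by (rule pair_graph_eberhard_graph)

sublocale F: residues q "residue_ring q"
  using p_gt_1 by unfold_locales simp_all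

lemma V_eq: "V = {0..<q} \<times> {0..<q}"
  by (auto simp: eberhard_graph_def residue_ring_def Let_def)

lemma mem_eberhard_set_mod_iff:
  "(a mod q, b mod q) \<in> eberhard_set p \<longleftrightarrow>
    \<not> [a = 0] (mod q) \<and> ([b = a\<^sup>2] (mod q) \<or> [b = - a\<^sup>2] (mod q))"
proof -
  have "(a mod q, b mod q) \<in> eberhard_set p \<longleftrightarrow> a mod q \<noteq> 0 \<and>
      (b mod q = (a mod q) [^]\<^bsub>residue_ring q\<^esub> (2::nat) \<or>
       b mod q = \<ominus>\<^bsub>residue_ring q\<^esub> ((a mod q) [^]\<^bsub>residue_ring q\<^esub> (2::nat)))"
    using p_gt_1 by (auto simp: eberhard_set_def Let_def F.res_carrier_eq F.res_zero_eq)
  then show ?thesis by (simp add: cong_def F.pow_cong F.neg_cong)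
qed

lemma arc_iff:
  "((x, y), (x', y')) \<in> E \<longleftrightarrow>
    x \<in> {0..<q} \<and> y \<in> {0..<q} \<and> x' \<in> {0..<q} \<and> y' \<in> {0..<q} \<and> x \<noteq> x' \<and>
    ([(x - x')\<^sup>2 = y - y'] (mod q) \<or> [(x - x')\<^sup>2 = y' - y] (mod q))"
proof -
  have "a \<ominus>\<^bsub>residue_ring q\<^esub> b = (a - b) mod q" for a b
    by (simp add: a_minus_def F.res_add_eq F.res_neg_eq mod_add_right_eq)
  then have "((x, y), (x', y')) \<in> E \<longleftrightarrow>
      x \<in> {0..<q} \<and> y \<in> {0..<q} \<and> x' \<in> {0..<q} \<and> y' \<in> {0..<q} \<and>
      ((x - x') mod q, (y - y') mod q) \<in> eberhard_set p"
    by (auto simp: eberhard_graph_def Let_def F.res_carrier_eq)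
  moreover have "[x - x' = 0] (mod q) \<longleftrightarrow> x = x'" if "x \<in> {0..<q}" "x' \<in> {0..<q}"
    using that cong_imp_eq_int[of x x' q] by (auto simp: cong_diff_iff_cong_0)
  moreover have "[y - y' = - (x - x')\<^sup>2] (mod q) \<longleftrightarrow> [y' - y = (x - x')\<^sup>2] (mod q)"
    using cong_minus_minus_iff[of "y' - y" "(x - x')\<^sup>2" q] by simp
  ultimately show ?thesis
    unfolding mem_eberhard_set_mod_iff by (auto simp: cong_sym_eq)
qed

subsection \<open>A Hamiltonian path\<close>

definition diagonal_walk :: "nat \<Rightarrow> int \<times> int" where
  "diagonal_walk n = (int (n mod p), (int n - 2 * int (n div p)) mod q)"

lemma diagonal_walk_step: "(diagonal_walk n, diagonal_walk (Suc n)) \<in> E"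
proof -
  let ?y = "\<lambda>k. int k - 2 * int (k div p)"
  have "n mod p \<noteq> Suc n mod p"
    using p_gt_1 by (simp add: mod_Suc)
  moreover have "[(int (n mod p) - int (Suc n mod p))\<^sup>2 = (int n - int (Suc n))\<^sup>2] (mod q)"
    by (intro cong_pow cong_diff) (simp_all only: cong_def zmod_int mod_mod_trivial)
  moreover have "[?y n mod q - ?y (Suc n) mod q = ?y n - ?y (Suc n)] (mod q)"
    "[?y (Suc n) mod q - ?y n mod q = ?y (Suc n) - ?y n] (mod q)"
    by (simp_all add: cong_def mod_simps)
  moreover have "?y n - ?y (Suc n) = 1 \<or> ?y (Suc n) - ?y n = 1"
    by (simp add: div_Suc)
  ultimately show ?thesis
    unfolding diagonal_walk_def arc_iff using p_gt_1
    by (auto simp: cong_def)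
qed

lemma inj_on_diagonal_walk: "inj_on diagonal_walk {..<p * p}"
proof (rule inj_onI)
  fix m n assume range: "m \<in> {..<p * p}" "n \<in> {..<p * p}"
    and eq: "diagonal_walk m = diagonal_walk n"
  have column: "m mod p = n mod p"
    using eq by (simp add: diagonal_walk_def)
  then have "[int m = int n] (mod q)"
    by (simp add: cong_def flip: zmod_int)
  moreover have "[int m - 2 * int (m div p) = int n - 2 * int (n div p)] (mod q)"
    using eq by (simp add: diagonal_walk_def cong_def)
  ultimately have "[int m - (int m - 2 * int (m div p)) = int n - (int n - 2 * int (n div p))] (mod q)"
    by (rule cong_diff)
  then have "[2 * int (m div p) = 2 * int (n div p)] (mod q)" by simp
  then have "[int (m div p) = int (n div p)] (mod q)"
    using odd_p by (simp add: cong_double_cancel)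
  moreover have "m div p < p" "n div p < p"
    using range by (simp_all add: less_mult_imp_div_less)
  ultimately have "m div p = n div p"
    using cong_imp_eq_int[of "int (m div p)" "int (n div p)" q] by simp
  with column show "m = n" by (metis div_mult_mod_eq)
qed

lemma diagonal_walk_image: "diagonal_walk ` {..<p * p} = V"
proof (rule card_subset_eq)
  show "diagonal_walk ` {..<p * p} \<subseteq> V"
    using p_gt_1 by (auto simp: diagonal_walk_def V_eq)
  show "card (diagonal_walk ` {..<p * p}) = card (V)"
    by (simp add: card_image inj_on_diagonal_walk V_eq card_cartesian_product)
qed (rule pair_finite_verts)

lemma chromatic_number_complement_le:
  "chromatic_number (complement_graph (eberhard_graph p)) \<le> (p * p + 1) div 2"
  using diagonal_walk_step diagonal_walk_image
  by (intro chromatic_number_complement_le_spanning_walk[OF pair_graph_axioms]) auto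

subsection \<open>Reflecting the columns\<close>

definition centre :: "int \<Rightarrow> int" where
  "centre x = (if x = 0 then 1 else if odd x then 0 else 2)"

definition mate :: "int \<Rightarrow> int" where
  "mate x = (if x = 0 then 0 else if odd x then x + 1 else x - 1)"

definition partner :: "int \<times> int \<Rightarrow> int \<times> int" where
  "partner = (\<lambda>(x, y).
    if y = centre x then (mate x, centre (mate x)) else (x, (2 * centre x - y) mod q))"

lemma partner_centre: "partner (x, centre x) = (mate x, centre (mate x))"
  by (simp add: partner_def)

lemma partner_column: "y \<noteq> centre x \<Longrightarrow> partner (x, y) = (x, (2 * centre x - y) mod q)"
  by (simp add: partner_def)

lemma centre_mem: "centre x \<in> {0..<q}"
proof -
  have "p \<noteq> 2" using odd_p by auto
  then show ?thesis using p_gt_1 by (simp add: centre_def)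
qed

lemma mate_mem:
  assumes "x \<in> {0..<q}"
  shows "mate x \<in> {0..<q}"
proof -
  have "x + 1 \<noteq> q" if "odd x"
    using that odd_p by (metis even_of_nat odd_even_add odd_one)
  with assms show ?thesis by (auto simp: mate_def)
qed

lemma mate_mate: "0 \<le> x \<Longrightarrow> mate (mate x) = x"
  by (auto simp: mate_def)

lemma reflection_neq_centre:
  assumes "y \<in> {0..<q}" "y \<noteq> centre x"
  shows "(2 * centre x - y) mod q \<noteq> centre x"
proof
  assume "(2 * centre x - y) mod q = centre x"
  then have "[2 * centre x - y = centre x] (mod q)"
    using centre_mem[of x] by (simp add: cong_def)
  then have "[2 * centre x - (2 * centre x - y) = 2 * centre x - centre x] (mod q)"
    by (rule cong_diff[OF cong_refl])
  then show False
    using assms centre_mem[of x] cong_imp_eq_int[of y "centre x" q] by simp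
qed

lemma reflection_neq:
  assumes "y \<in> {0..<q}" "y \<noteq> centre x"
  shows "(2 * centre x - y) mod q \<noteq> y"
proof
  assume "(2 * centre x - y) mod q = y"
  then have "[2 * centre x - y = y] (mod q)"
    using assms(1) by (simp add: cong_def)
  then have "[2 * centre x = 2 * y] (mod q)"
    using cong_add_rcancel[of "2 * centre x - y" y y q] by simp
  then have "[centre x = y] (mod q)"
    using odd_p by (simp add: cong_double_cancel)
  then show False
    using assms centre_mem[of x] cong_imp_eq_int[of "centre x" y q] by simp
qed

lemma partner_mem:
  assumes "v \<in> V"
  shows "partner v \<in> V"
  using assms p_gt_1 centre_mem mate_mem by (auto simp: partner_def V_eq)

lemma partner_partner:
  assumes "v \<in> V"
  shows "partner (partner v) = v"
proof -
  obtain x y where v: "v = (x, y)" "x \<in> {0..<q}" "y \<in> {0..<q}"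
    using assms by (auto simp: V_eq)
  show ?thesis
  proof (cases "y = centre x")
    case True
    then show ?thesis using v by (simp add: partner_centre mate_mate)
  next
    case False
    then show ?thesis
      using v reflection_neq_centre[OF v(3) False] by (simp add: partner_column mod_simps)
  qed
qed

lemma partner_not_adjacent:
  assumes "5 < p"
  shows "(v, partner v) \<notin> E"
proof -
  have "\<not> q dvd 1" "\<not> q dvd 3" "\<not> q dvd -1" "\<not> q dvd -3"
    using assms zdvd_imp_le[of q 3] by auto
  then show ?thesis
    by (cases v)
      (auto simp: partner_def mate_def centre_def arc_iff cong_iff_dvd_diff)
qed

lemma partner_same_level:
  assumes "v \<in> V" "snd (partner v) = snd v"
  shows "v = (0, 1)"
proof -
  obtain x y where v: "v = (x, y)" "y \<in> {0..<q}"
    using assms(1) by (auto simp: V_eq)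
  then have y: "y = centre x"
    using assms(2) reflection_neq partner_column by (metis snd_conv)
  then have "x = 0"
    using assms(2) v by (auto simp: partner_def mate_def centre_def split: if_splits)
  with v y show ?thesis by (simp add: centre_def)
qed

lemma centre_pair:
  assumes "0 < x"
  obtains a where "{(x, centre x), partner (x, centre x)} = {(a, 0), (a + 1, 2)}"
proof (cases "odd x")
  case True
  then have "(x, centre x) = (x, 0)" "partner (x, centre x) = (x + 1, 2)"
    using assms by (auto simp: partner_def mate_def centre_def)
  then show ?thesis using that by metis
next
  case False
  then have "(x, centre x) = (x - 1 + 1, 2)" "partner (x, centre x) = (x - 1, 0)"
    using assms by (auto simp: partner_def mate_def centre_def)
  then show ?thesis using that by (metis insert_commute)
qed

subsection \<open>No two orbits are completely joined\<close>

lemma column_common_neighbour: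
  assumes "y \<noteq> z" "((x, y), (a, b)) \<in> E" "((x, z), (a, b)) \<in> E"
  shows "[y + z = 2 * b] (mod q)"
proof -
  let ?s = "(x - a)\<^sup>2"
  have range: "y \<in> {0..<q}" "z \<in> {0..<q}"
    and y: "[?s = y - b] (mod q) \<or> [?s = b - y] (mod q)"
    and z: "[?s = z - b] (mod q) \<or> [?s = b - z] (mod q)"
    using assms(2,3) by (auto simp: arc_iff)
  consider (equal) "[y - b = z - b] (mod q)" | (opposite) "[y - b = b - z] (mod q)"
    using y z by (metis cong_minus_minus_iff cong_sym cong_trans minus_diff_eq)
  then show ?thesis
  proof cases
    case equal
    then have "[y = z] (mod q)" by (simp add: cong_iff_dvd_diff)
    then show ?thesis using range assms(1) cong_imp_eq_int by blast
  next
    case opposite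
    then show ?thesis by (simp add: cong_iff_dvd_diff algebra_simps)
  qed
qed

lemma column_pair_common_neighbour_level:
  assumes "y \<noteq> centre x" "((x, y), (a, b)) \<in> E" "(partner (x, y), (a, b)) \<in> E"
  shows "b = centre x"
proof -
  let ?z = "(2 * centre x - y) mod q"
  have range: "y \<in> {0..<q}" "b \<in> {0..<q}"
    using assms(2) by (auto simp: arc_iff)
  have "[2 * b = y + ?z] (mod q)"
    using assms reflection_neq[OF range(1) assms(1)]
    by (intro cong_sym[OF column_common_neighbour[of y ?z x a b]]) (auto simp: partner_column)
  also have "[y + ?z = 2 * centre x] (mod q)"
    by (simp add: cong_def mod_simps)
  finally have "[b = centre x] (mod q)"
    using odd_p by (simp add: cong_double_cancel)
  then show ?thesis
    using range centre_mem cong_imp_eq_int by blast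
qed

lemma column_pair_not_joined:
  assumes "y \<noteq> centre x" and w: "w \<in> V"
  shows "\<not> {(x, y), partner (x, y)} \<times> {w, partner w} \<subseteq> E"
proof
  assume joined: "{(x, y), partner (x, y)} \<times> {w, partner w} \<subseteq> E"
  have "snd u = centre x" if "u \<in> {w, partner w}" for u
    using column_pair_common_neighbour_level[OF assms(1), of "fst u" "snd u"] joined that by auto
  then have level: "snd w = centre x" and "snd (partner w) = snd w" by simp_all
  with w have "w = (0, 1)" by (intro partner_same_level)
  moreover from this level have "x = 0" by (simp add: centre_def split: if_splits)
  ultimately show False
    using joined by (auto simp: arc_iff)
qed

lemma fixed_centre_not_joined:
  assumes "5 < p"
  shows "\<not> {(0, 1)} \<times> {(a, 0), (a + 1, 2)} \<subseteq> E"
proof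
  assume "{(0, 1)} \<times> {(a, 0), (a + 1, 2)} \<subseteq> E"
  then have "[a\<^sup>2 = 1] (mod q) \<or> [a\<^sup>2 = -1] (mod q)"
    "[(- a - 1)\<^sup>2 = 1] (mod q) \<or> [(- a - 1)\<^sup>2 = -1] (mod q)"
    by (auto simp: arc_iff)
  moreover have "(- a - 1)\<^sup>2 = (a + 1)\<^sup>2" by (simp add: power2_eq_square algebra_simps)
  ultimately show False
    using assms not_consecutive_squares_pm_one[of q a] by auto
qed

lemma centre_pairs_not_joined:
  assumes "5 < p"
  shows "\<not> {(a, 0), (a + 1, 2)} \<times> {(b, 0), (b + 1, 2)} \<subseteq> E"
proof
  assume "{(a, 0), (a + 1, 2)} \<times> {(b, 0), (b + 1, 2)} \<subseteq> E"
  then have "[(a - b)\<^sup>2 = 0] (mod q)"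
    "[(a - b - 1)\<^sup>2 = 2] (mod q) \<or> [(a - b - 1)\<^sup>2 = -2] (mod q)"
    "[(a - b + 1)\<^sup>2 = 2] (mod q) \<or> [(a - b + 1)\<^sup>2 = -2] (mod q)"
    by (auto simp: arc_iff algebra_simps)
  then show False
    using assms odd_p not_zero_square_between_squares_pm_two[of q "a - b"] by simp
qed

lemma partner_orbits_not_joined:
  assumes "5 < p" and v: "v \<in> V" and w: "w \<in> V"
  shows "\<not> {v, partner v} \<times> {w, partner w} \<subseteq> E"
proof
  assume joined: "{v, partner v} \<times> {w, partner w} \<subseteq> E"
  then have joined_sym: "{w, partner w} \<times> {v, partner v} \<subseteq> E"
    using arcs_symmetric by blast
  obtain x where x: "v = (x, centre x)"
    using joined column_pair_not_joined w by (metis prod.exhaust)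
  obtain y where y: "w = (y, centre y)"
    using joined_sym column_pair_not_joined v by (metis prod.exhaust)
  have fixed: "{(0, centre 0), partner (0, centre 0)} = {(0, 1)}"
    by (simp add: partner_def mate_def centre_def)
  have "0 \<le> x" "0 \<le> y" using v w by (simp_all add: x y V_eq)
  then consider (both_fixed) "x = 0" "y = 0" | (left_fixed) "x = 0" "0 < y"
    | (right_fixed) "0 < x" "y = 0" | (none_fixed) "0 < x" "0 < y"
    by linarith
  then show False
  proof cases
    case both_fixed
    with joined show False by (simp add: x y arc_iff)
  next
    case left_fixed
    obtain b where "{w, partner w} = {(b, 0), (b + 1, 2)}"
      using centre_pair[OF left_fixed(2)] y by metis
    with joined left_fixed(1) x fixed fixed_centre_not_joined[OF assms(1), of b] show False by simp
  next
    case right_fixed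
    obtain a where "{v, partner v} = {(a, 0), (a + 1, 2)}"
      using centre_pair[OF right_fixed(1)] x by metis
    with joined_sym right_fixed(2) y fixed fixed_centre_not_joined[OF assms(1), of a] show False by simp
  next
    case none_fixed
    obtain a where "{v, partner v} = {(a, 0), (a + 1, 2)}"
      using centre_pair[OF none_fixed(1)] x by metis
    moreover obtain b where "{w, partner w} = {(b, 0), (b + 1, 2)}"
      using centre_pair[OF none_fixed(2)] y by metis
    ultimately show False
      using joined centre_pairs_not_joined[OF assms(1), of a b] by metis
  qed
qed

lemma complete_model_complement:
  assumes "5 < p" "t \<le> (p * p + 1) div 2"
  obtains \<B> where "complete_model (complement_graph (eberhard_graph p)) t \<B>" "\<forall>B \<in> \<B>. card B \<le> 2"
proof -
  let ?\<B> = "(\<lambda>v. {v, partner v}) ` V"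
  have "complete_model (complement_graph (eberhard_graph p)) (card ?\<B>) ?\<B>"
    using partner_mem partner_partner partner_not_adjacent partner_orbits_not_joined assms(1)
    by (intro complete_model_complement_involution pair_finite_verts)
  moreover have "t \<le> card ?\<B>"
  proof -
    have "p * p \<le> 2 * card ?\<B>"
      using card_le_double_card_pairs[of "V" partner] pair_finite_verts
      by (simp add: V_eq card_cartesian_product)
    with assms(2) show ?thesis by linarith
  qed
  ultimately obtain \<C> where "\<C> \<subseteq> ?\<B>" "complete_model (complement_graph (eberhard_graph p)) t \<C>"
    by (rule complete_model_subset)
  moreover have "card B \<le> 2" if "B \<in> ?\<B>" for B
    using that by (auto simp: card_insert_if)
  ultimately show ?thesis using that by blast
qed

end

theorem theorem3p22:
  fixes p :: nat
  assumes "prime p" and "[p = 11] (mod 12)"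
  defines "H \<equiv> complement_graph (eberhard_graph p)"
  shows "\<exists>\<B>. complete_model H (chromatic_number H) \<B> \<and> (\<forall>B \<in> \<B>. card B \<le> 2)"
proof -
  have "p mod 12 = 11" using assms(2) by (simp add: cong_def)
  then have p: "odd p" "5 < p" by presburger+
  interpret odd_eberhard p using p by unfold_locales simp_all
  show ?thesis
    unfolding H_def using complete_model_complement[OF p(2) chromatic_number_complement_le] by blast
qed

end
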